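(* Let $G$ be a residually finite group. For every isometric action of $G$ on a metric space $(X,d)$ there exist an index set $I$, an ultrafilter $\mathcal{U}$ on $I$, and a family $(Y_i,\eta_i)_{i\in I}$ of finite metric spaces, each equipped with an isometric action of $G$, together with a $G$-equivariant isometric (i.e. distance-preserving) embedding of $(X,d)$ into the metric ultraproduct of the family $(Y_i,\eta_i)_{i\in I}$ along $\mathcal{U}$, endowed with the induced action of $G$.
   Context: All groups are discrete. A group $G$ with identity $e$ is residually finite if for every $g\in G\setminus\{e\}$ there exist a finite group $Q$ and a homomorphism $\psi\colon G\to Q$ with $\psi(g)\neq e$. An isometric action of $G$ on a metric space is a group action in which every group element acts by a distance-preserving map. Metric ultraproduct: given metric spaces $(Y_i,\eta_i)$ with isometric $G$-actions, $i \in I$, and an ultrafilter $\mathcal{U}$ on $I$, define on $\prod_{i\in I} Y_i$ the (possibly infinite-valued) pseudometric $\eta_{\mathcal{U}}((y_i)_i,(z_i)_i) := \lim_{i\to\mathcal{U}} \eta_i(y_i,z_i)\in[0,\infty]$. The metric ultraproduct is the quotient of $\prod_{i\in I} Y_i$ obtained by identifying points at $\eta_{\mathcal{U}}$-distance $0$, with the induced metric (which is allowed to take the value $\infty$, since no uniform bound on the diameters of the $Y_i$ is imposed; the image of an isometric embedding of a metric space lies in a set of points at pairwise finite distance). The group $G$ acts on it isometrically by the coordinatewise action $g\cdot[(y_i)_i] = [(g\cdot y_i)_i]$. *)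

theory Defs
  imports "HOL-Analysis.Analysis" "HOL-Algebra.Group_Action" "HOL-Algebra.Weak_Morphisms"
begin

section \<open>Residually finite groups\<close>

text \<open>
  A definition cannot quantify over types, so the finite quotient is sought among groups whose
  carrier is a set of natural numbers.  Every finite group has such a copy; the lemma
  \<open>residually_finiteI\<close> shows that finite quotients of any other type serve equally well.
\<close>

definition residually_finite :: "('g, 'm) monoid_scheme \<Rightarrow> bool"
  where "residually_finite G \<longleftrightarrow>
    group G \<and>
    (\<forall>g \<in> carrier G - {\<one>\<^bsub>G\<^esub>}.
       \<exists>(Q :: nat monoid) \<psi>.
         group Q \<and> finite (carrier Q) \<and> \<psi> \<in> hom G Q \<and> \<psi> g \<noteq> \<one>\<^bsub>Q\<^esub>)"

lemma residually_finiteI: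
  fixes G :: "('g, 'm) monoid_scheme"
  assumes "group G"
    and Q: "\<And>g. g \<in> carrier G - {\<one>\<^bsub>G\<^esub>} \<Longrightarrow>
      \<exists>(Q :: ('q, 'n) monoid_scheme) \<psi>.
         group Q \<and> finite (carrier Q) \<and> \<psi> \<in> hom G Q \<and> \<psi> g \<noteq> \<one>\<^bsub>Q\<^esub>"
  shows "residually_finite G"
  unfolding residually_finite_def
proof (intro conjI ballI)
  fix g assume g: "g \<in> carrier G - {\<one>\<^bsub>G\<^esub>}"
  obtain Q :: "('q, 'n) monoid_scheme" and \<psi> where
    gQ: "group Q" and fin: "finite (carrier Q)" and hom: "\<psi> \<in> hom G Q" and ne: "\<psi> g \<noteq> \<one>\<^bsub>Q\<^esub>"
    using Q[OF g] by blast
  obtain h :: "'q \<Rightarrow> nat" where inj: "inj_on h (carrier Q)"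
    using finite_imp_inj_to_nat_seg[OF fin] by blast
  interpret Q: group Q by (rule gQ)
  have grp: "group (image_group h Q)"
    by (rule Q.inj_imp_image_group_is_group[OF inj])
  have "h \<in> hom Q (image_group h Q)"
    using inj_imp_image_group_iso[OF inj] by (simp add: iso_def)
  then have "h \<circ> \<psi> \<in> hom G (image_group h Q)"
    by (rule Group.hom_compose[OF hom])
  moreover have "(h \<circ> \<psi>) g \<noteq> \<one>\<^bsub>image_group h Q\<^esub>"
  proof -
    have "\<psi> g \<in> carrier Q" using g hom by (auto simp: hom_def)
    then show ?thesis using ne inj by (simp add: image_group_one inj_on_eq_iff)
  qed
  moreover have "finite (carrier (image_group h Q))"
    using fin by (simp add: image_group_carrier)
  ultimately show "\<exists>(Q :: nat monoid) \<psi>.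
      group Q \<and> finite (carrier Q) \<and> \<psi> \<in> hom G Q \<and> \<psi> g \<noteq> \<one>\<^bsub>Q\<^esub>"
    using grp by blast
qed (rule assms)


section \<open>Isometric actions\<close>

locale isometric_action = group_action G X \<phi> + Metric_space X d
  for G :: "('g, 'm) monoid_scheme" (structure) and X :: "'a set" and d \<phi> +
  assumes isometric:
    "\<lbrakk>g \<in> carrier G; x \<in> X; y \<in> X\<rbrakk> \<Longrightarrow> d (\<phi> g x) (\<phi> g y) = d x y"


section \<open>Metric ultraproducts\<close>

text \<open>
  An ultrafilter on the set \<open>I\<close> is represented by a filter on the ambient type that contains \<open>I\<close>.

  Index sets and factors can be existentially quantified only inside fixed types.  Finite factors can
  be taken in \<open>nat\<close> without loss of generality; for a group on \<open>'g\<close> acting on a space on \<open>'x\<close>, the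
  index type \<open>'g set \<times> 'x set \<times> nat\<close> has room for finite subsets of both together with a
  precision, and existence of \<open>I\<close> in a fixed type implies plain existence.
\<close>

definition ultrafilter_on :: "'i set \<Rightarrow> 'i filter \<Rightarrow> bool"
  where "ultrafilter_on I U \<longleftrightarrow>
    U \<noteq> bot \<and> U \<le> principal I \<and>
    (\<forall>P. eventually P U \<or> eventually (\<lambda>i. \<not> P i) U)"

definition up_pdist ::
    "'i filter \<Rightarrow> ('i \<Rightarrow> 'y \<Rightarrow> 'y \<Rightarrow> real) \<Rightarrow> ('i \<Rightarrow> 'y) \<Rightarrow> ('i \<Rightarrow> 'y) \<Rightarrow> ennreal"
  where "up_pdist U \<eta> y z = Lim U (\<lambda>i. ennreal (\<eta> i (y i) (z i)))"

definition up_rel ::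
    "'i set \<Rightarrow> 'i filter \<Rightarrow> ('i \<Rightarrow> 'y set) \<Rightarrow> ('i \<Rightarrow> 'y \<Rightarrow> 'y \<Rightarrow> real) \<Rightarrow> ('i \<Rightarrow> 'y) rel"
  where "up_rel I U Y \<eta> =
    {(y, z). y \<in> Pi\<^sub>E I Y \<and> z \<in> Pi\<^sub>E I Y \<and> up_pdist U \<eta> y z = 0}"

definition up_space ::
    "'i set \<Rightarrow> 'i filter \<Rightarrow> ('i \<Rightarrow> 'y set) \<Rightarrow> ('i \<Rightarrow> 'y \<Rightarrow> 'y \<Rightarrow> real) \<Rightarrow> ('i \<Rightarrow> 'y) set set"
  where "up_space I U Y \<eta> = Pi\<^sub>E I Y // up_rel I U Y \<eta>"

text \<open>
  The induced distance and action are defined from all representatives of the classes; independence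
  of the representatives is \<open>up_dist_class\<close> and \<open>up_action_class\<close> below.
\<close>

definition up_dist ::
    "'i filter \<Rightarrow> ('i \<Rightarrow> 'y \<Rightarrow> 'y \<Rightarrow> real) \<Rightarrow> ('i \<Rightarrow> 'y) set \<Rightarrow> ('i \<Rightarrow> 'y) set \<Rightarrow> ennreal"
  where "up_dist U \<eta> A B = the_elem ((\<lambda>(y, z). up_pdist U \<eta> y z) ` (A \<times> B))"

definition up_action ::
    "'i set \<Rightarrow> 'i filter \<Rightarrow> ('i \<Rightarrow> 'y set) \<Rightarrow> ('i \<Rightarrow> 'y \<Rightarrow> 'y \<Rightarrow> real) \<Rightarrow>
     ('i \<Rightarrow> 'g \<Rightarrow> 'y \<Rightarrow> 'y) \<Rightarrow> 'g \<Rightarrow> ('i \<Rightarrow> 'y) set \<Rightarrow> ('i \<Rightarrow> 'y) set"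
  where "up_action I U Y \<eta> \<phi> g =
    (\<lambda>A \<in> up_space I U Y \<eta>. \<Union>y \<in> A. up_rel I U Y \<eta> `` {\<lambda>i \<in> I. \<phi> i g (y i)})"


subsection \<open>The ultraproduct is a metric space with an isometric action\<close>

lemma ultrafilter_on_convergent:
  fixes f :: "'i \<Rightarrow> 'b::{complete_linorder,linorder_topology,second_countable_topology}"
  assumes "ultrafilter_on I U"
  shows "\<exists>l. (f \<longlongrightarrow> l) U"
proof -
  let ?F = "filtermap f U"
  have bot: "?F \<noteq> bot"
    using assms by (simp add: ultrafilter_on_def filtermap_bot_iff)
  obtain l where l: "inf (nhds l) ?F \<noteq> bot"
    using compact_UNIV[unfolded compact_filter] bot by (auto simp: top_unique)
  have "eventually (\<lambda>i. f i \<in> S) U" if S: "open S" "l \<in> S" for S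
  proof (rule ccontr)
    assume "\<not> eventually (\<lambda>i. f i \<in> S) U"
    then have "eventually (\<lambda>i. f i \<notin> S) U"
      using assms by (auto simp: ultrafilter_on_def)
    then have "eventually (\<lambda>x. x \<notin> S) ?F" by (simp add: eventually_filtermap)
    moreover have "eventually (\<lambda>x. x \<in> S) (nhds l)" using S by (rule eventually_nhds_in_open)
    ultimately have "eventually (\<lambda>x. False) (inf (nhds l) ?F)"
      unfolding eventually_inf by blast
    then show False using l by (simp add: trivial_limit_def)
  qed
  then show ?thesis by (auto simp: tendsto_def)
qed

locale isometric_action_family =
  fixes G :: "('g, 'm) monoid_scheme" (structure)
    and I :: "'i set" and U :: "'i filter"
    and Y :: "'i \<Rightarrow> 'y set" and \<eta> :: "'i \<Rightarrow> 'y \<Rightarrow> 'y \<Rightarrow> real" and \<phi> :: "'i \<Rightarrow> 'g \<Rightarrow> 'y \<Rightarrow> 'y"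
  assumes ultra: "ultrafilter_on I U"
    and act: "i \<in> I \<Longrightarrow> isometric_action G (Y i) (\<eta> i) (\<phi> i)"
    and grp: "group G"
begin

abbreviation "E \<equiv> Pi\<^sub>E I Y"
abbreviation "R \<equiv> up_rel I U Y \<eta>"
abbreviation "D \<equiv> up_pdist U \<eta>"
abbreviation "S \<equiv> up_space I U Y \<eta>"
abbreviation "a \<equiv> up_action I U Y \<eta> \<phi>"

definition c :: "'g \<Rightarrow> ('i \<Rightarrow> 'y) \<Rightarrow> 'i \<Rightarrow> 'y"
  where "c g y = (\<lambda>i \<in> I. \<phi> i g (y i))"

lemma ev_I: "eventually (\<lambda>i. i \<in> I) U"
  using ultra by (simp add: ultrafilter_on_def le_principal)

lemma U_nontriv: "U \<noteq> bot"
  using ultra by (simp add: ultrafilter_on_def)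

lemma ev_on: "(\<And>i. i \<in> I \<Longrightarrow> P i) \<Longrightarrow> eventually P U"
  by (rule eventually_mono[OF ev_I])

lemma met: "i \<in> I \<Longrightarrow> Metric_space (Y i) (\<eta> i)"
  using act by (simp add: isometric_action_def)

lemma gact: "i \<in> I \<Longrightarrow> group_action G (Y i) (\<phi> i)"
  using act by (simp add: isometric_action_def)

lemma pdist_lim: "((\<lambda>i. ennreal (\<eta> i (y i) (z i))) \<longlongrightarrow> D y z) U"
proof -
  obtain l where l: "((\<lambda>i. ennreal (\<eta> i (y i) (z i))) \<longlongrightarrow> l) U"
    using ultrafilter_on_convergent[OF ultra] by blast
  then have "D y z = l"
    unfolding up_pdist_def using U_nontriv by (intro tendsto_Lim) auto
  with l show ?thesis by simp
qed

lemma pdistI: "((\<lambda>i. ennreal (\<eta> i (y i) (z i))) \<longlongrightarrow> l) U \<Longrightarrow> D y z = l"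
  using tendsto_unique[OF U_nontriv pdist_lim] by blast

lemma pdist_cong:
  assumes "\<And>i. i \<in> I \<Longrightarrow> \<eta> i (y i) (z i) = \<eta> i (y' i) (z' i)"
  shows "D y z = D y' z'"
proof (rule pdistI)
  show "((\<lambda>i. ennreal (\<eta> i (y i) (z i))) \<longlongrightarrow> D y' z') U"
    by (rule Lim_transform_eventually[OF pdist_lim[of y' z']], rule ev_on) (simp add: assms)
qed

lemma pdist_refl: "y \<in> E \<Longrightarrow> D y y = 0"
proof (rule pdistI)
  assume y: "y \<in> E"
  show "((\<lambda>i. ennreal (\<eta> i (y i) (y i))) \<longlongrightarrow> 0) U"
  proof (rule tendsto_eventually, rule ev_on)
    fix i assume i: "i \<in> I"
    then have "y i \<in> Y i" using y by auto
    then show "ennreal (\<eta> i (y i) (y i)) = 0" using Metric_space.zero[OF met[OF i], of "y i" "y i"] by simp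
  qed
qed

lemma pdist_commute: "D y z = D z y"
  by (rule pdist_cong) (simp add: Metric_space.commute[OF met])

lemma pdist_triangle:
  assumes "x \<in> E" "y \<in> E" "z \<in> E"
  shows "D x z \<le> D x y + D y z"
proof (rule tendsto_le[OF U_nontriv tendsto_add[OF pdist_lim pdist_lim] pdist_lim], rule ev_on)
  fix i assume i: "i \<in> I"
  interpret Metric_space "Y i" "\<eta> i" by (rule met[OF i])
  have "x i \<in> Y i" "y i \<in> Y i" "z i \<in> Y i" using assms i by auto
  then show "ennreal (\<eta> i (x i) (z i)) \<le> ennreal (\<eta> i (x i) (y i)) + ennreal (\<eta> i (y i) (z i))"
    by (simp add: triangle flip: ennreal_plus)
qed

lemma equiv_rel: "equiv E R"
proof (rule equivI)
  show "R \<subseteq> E \<times> E" by (auto simp: up_rel_def)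
  show "refl_on E R" by (auto simp: up_rel_def refl_on_def pdist_refl)
  show "sym R" by (auto simp: up_rel_def sym_def pdist_commute)
  show "trans R"
  proof (rule transI)
    fix x y z assume "(x, y) \<in> R" "(y, z) \<in> R"
    then show "(x, z) \<in> R" using pdist_triangle[of x y z] by (auto simp: up_rel_def)
  qed
qed

lemma pdist_rel:
  assumes "(y, y') \<in> R" "(z, z') \<in> R"
  shows "D y z = D y' z'"
proof -
  have *: "D y z \<le> D y' z'" if "(y, y') \<in> R" "(z, z') \<in> R" for y y' z z'
  proof -
    have E: "y \<in> E" "y' \<in> E" "z \<in> E" "z' \<in> E" and 0: "D y y' = 0" "D z z' = 0"
      using that by (auto simp: up_rel_def)
    have "D y z \<le> D y y' + D y' z" using E by (intro pdist_triangle)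
    also have "\<dots> \<le> D y y' + (D y' z' + D z' z)" using E by (intro add_mono pdist_triangle order_refl)
    finally show ?thesis using 0 by (simp add: pdist_commute[of z'])
  qed
  have "sym R" using equiv_rel by (simp add: equiv_def)
  then show ?thesis using assms by (intro antisym *) (auto dest: symD)
qed

lemma up_dist_class:
  assumes "y \<in> E" "z \<in> E"
  shows "up_dist U \<eta> (R `` {y}) (R `` {z}) = D y z"
proof -
  have "(\<lambda>(y, z). D y z) ` (R `` {y} \<times> R `` {z}) = {D y z}"
  proof
    show "{D y z} \<subseteq> (\<lambda>(y, z). D y z) ` (R `` {y} \<times> R `` {z})"
      using assms equiv_class_self[OF equiv_rel] by force
    show "(\<lambda>(y, z). D y z) ` (R `` {y} \<times> R `` {z}) \<subseteq> {D y z}"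
      using pdist_rel by fastforce
  qed
  then show ?thesis by (simp add: up_dist_def)
qed

lemma coord_closed: "g \<in> carrier G \<Longrightarrow> y \<in> E \<Longrightarrow> c g y \<in> E"
  using group_action.element_image[OF gact] by (auto simp: c_def PiE_iff)

lemma coord_isometric:
  assumes "g \<in> carrier G" "y \<in> E" "z \<in> E"
  shows "D (c g y) (c g z) = D y z"
proof (rule pdist_cong)
  fix i assume i: "i \<in> I"
  then have "y i \<in> Y i" "z i \<in> Y i" using assms by auto
  then show "\<eta> i (c g y i) (c g z i) = \<eta> i (y i) (z i)"
    using isometric_action.isometric[OF act[OF i] assms(1)] i by (simp add: c_def)
qed

lemma coord_rel: "g \<in> carrier G \<Longrightarrow> (y, z) \<in> R \<Longrightarrow> (c g y, c g z) \<in> R"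
  using coord_closed coord_isometric by (auto simp: up_rel_def)

lemma up_action_class:
  assumes "g \<in> carrier G" "y \<in> E"
  shows "a g (R `` {y}) = R `` {c g y}"
proof -
  have "(\<lambda>y. R `` {c g y}) respects R"
    by (intro congruentI equiv_class_eq[OF equiv_rel] coord_rel assms)
  from UN_equiv_class[OF equiv_rel this assms(2)]
  show ?thesis using assms by (simp add: up_action_def up_space_def quotientI c_def)
qed

lemma up_spaceE:
  assumes "A \<in> S" obtains y where "y \<in> E" "A = R `` {y}"
  using assms by (auto simp: up_space_def elim: quotientE)

lemma up_classI: "y \<in> E \<Longrightarrow> R `` {y} \<in> S"
  by (simp add: up_space_def quotientI)

lemma up_dist_eq_0_iff: "A \<in> S \<Longrightarrow> B \<in> S \<Longrightarrow> up_dist U \<eta> A B = 0 \<longleftrightarrow> A = B"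
  by (elim up_spaceE) (auto simp: up_dist_class eq_equiv_class_iff[OF equiv_rel], auto simp: up_rel_def)

lemma up_dist_commute: "A \<in> S \<Longrightarrow> B \<in> S \<Longrightarrow> up_dist U \<eta> A B = up_dist U \<eta> B A"
  by (elim up_spaceE) (simp add: up_dist_class pdist_commute)

lemma up_dist_triangle:
  "A \<in> S \<Longrightarrow> B \<in> S \<Longrightarrow> C \<in> S \<Longrightarrow> up_dist U \<eta> A C \<le> up_dist U \<eta> A B + up_dist U \<eta> B C"
  by (elim up_spaceE) (simp add: up_dist_class pdist_triangle)

lemma up_action_isometric:
  "g \<in> carrier G \<Longrightarrow> A \<in> S \<Longrightarrow> B \<in> S \<Longrightarrow> up_dist U \<eta> (a g A) (a g B) = up_dist U \<eta> A B"
  by (elim up_spaceE) (simp add: up_dist_class up_action_class coord_closed coord_isometric)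

lemma up_action_closed: "g \<in> carrier G \<Longrightarrow> A \<in> S \<Longrightarrow> a g A \<in> S"
  by (elim up_spaceE) (simp add: up_action_class coord_closed up_classI)

lemma up_action_mult:
  assumes "g \<in> carrier G" "h \<in> carrier G" "A \<in> S"
  shows "a (g \<otimes> h) A = a g (a h A)"
proof -
  interpret group G by (rule grp)
  obtain y where y: "y \<in> E" "A = R `` {y}" using assms by (elim up_spaceE)
  have "c (g \<otimes> h) y = c g (c h y)"
  proof
    fix i show "c (g \<otimes> h) y i = c g (c h y) i"
      using group_action.composition_rule[OF gact, of i "y i" g h] assms y by (auto simp: c_def)
  qed
  then show ?thesis using assms y by (simp add: up_action_class coord_closed)
qed

lemma up_action_one:
  assumes "A \<in> S" shows "a \<one> A = A"
proof -
  interpret group G by (rule grp)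
  obtain y where y: "y \<in> E" "A = R `` {y}" using assms by (elim up_spaceE)
  have "c \<one> y = y"
  proof
    fix i show "c \<one> y i = y i"
      using group_action.id_eq_one[OF gact, of i, symmetric] y by (cases "i \<in> I") (auto simp: c_def PiE_iff extensional_def fun_eq_iff)
  qed
  then show ?thesis using y by (simp add: up_action_class)
qed

theorem up_group_action: "group_action G S a"
proof -
  interpret group G by (rule grp)
  have bij: "a g \<in> Bij S" if g: "g \<in> carrier G" for g
  proof -
    have "bij_betw (a g) S S"
    proof (rule bij_betw_byWitness[where f' = "a (inv g)"])
      show "\<forall>A\<in>S. a (inv g) (a g A) = A" "\<forall>A\<in>S. a g (a (inv g) A) = A"
        using g by (simp_all add: up_action_one flip: up_action_mult)
    qed (use g up_action_closed in auto)
    then show ?thesis by (simp add: Bij_def up_action_def)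
  qed
  have "a \<in> hom G (BijGroup S)"
  proof (rule homI)
    fix g h assume gh: "g \<in> carrier G" "h \<in> carrier G"
    have "a (g \<otimes> h) = compose S (a g) (a h)"
    proof
      fix A show "a (g \<otimes> h) A = compose S (a g) (a h) A"
        using gh by (cases "A \<in> S") (simp_all add: compose_def up_action_mult, simp add: up_action_def)
    qed
    then show "a (g \<otimes> h) = a g \<otimes>\<^bsub>BijGroup S\<^esub> a h"
      using gh bij by (simp add: BijGroup_def)
  qed (use bij in \<open>simp add: BijGroup_def\<close>)
  then show ?thesis
    by (simp add: group_action_def group_hom_def group_hom_axioms_def grp group_BijGroup)
qed

end

end

theory Submission
  imports Defs
begin

text \<open>
  It suffices to approximate \<open>X\<close> on finite data: for finite \<open>F \<subseteq> G\<close> and \<open>S \<subseteq> X\<close> and any \<open>e > 0\<close>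
  there are a finite \<open>G\<close>-metric space \<open>Y\<close> and a map \<open>p : X \<rightarrow> Y\<close> that changes the distances on
  \<open>S\<close> by at most \<open>e\<close> and satisfies \<open>p (g x) \<approx> g (p x)\<close> up to \<open>e\<close> for \<open>g \<in> F\<close> whenever \<open>x\<close> and
  \<open>g x\<close> lie in \<open>S\<close> (\<open>residually_finite_finite_approximation\<close>).  The triples \<open>(F, S, n)\<close>, standing
  for these data with \<open>e = 1 / (n + 1)\<close>, are directed, and along an ultrafilter refining this
  direction (\<open>proper_filter_le_ultrafilter\<close>) all errors vanish, so that the maps \<open>p\<close> assemble to
  an equivariant isometric embedding.

  A quotient of \<open>X\<close> itself would not do in general, since passing to a finite quotient of \<open>G\<close> may
  collapse far too much: a point stabiliser need not be closed in the profinite topology.  Instead the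
  relation of the points to \<open>G\<close> is slightly loosened.  On \<open>G \<times> S\<close>, where \<open>(a, s)\<close> stands for \<open>a s\<close>,
  \<open>G\<close> acts by left multiplication on the first factor, and for \<open>\<delta> = e / 2\<close>

    \<open>\<sigma> (a, s) (b, t) = d (a s) (b t) + \<delta> * (w (a\<^sup>-\<^sup>1 b) + of_bool (s \<noteq> t))\<close>

  is an invariant metric, for \<open>w\<close> the word length with respect to \<open>F\<close> and its inverses, capped
  at a large number \<open>M\<close> (\<open>group.exists_capped_length\<close>).  Let \<open>Y\<close> be the quotient of \<open>G \<times> S\<close> by
  a normal subgroup \<open>N\<close> of finite index, with the infimum distance between \<open>N\<close>-orbits
  (\<open>finite_orbit_space_action\<close>), and let \<open>p s\<close> be the orbit of \<open>(1, s)\<close>.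

  The set \<open>{w < M}\<close> is finite, so residual finiteness yields an \<open>N\<close> that meets it only in \<open>1\<close>
  (\<open>residually_finite_separating_normal\<close>).  Any two distinct elements \<open>n, m\<close> of \<open>N\<close> then have
  \<open>w (n\<^sup>-\<^sup>1 m) = M\<close>; if \<open>\<delta> M\<close> exceeds the diameter of \<open>S\<close>, passing to the quotient creates no
  shortcut between \<open>(1, s)\<close> and \<open>(1, t)\<close>, and their orbits are at distance at least \<open>d s t\<close>.
  Equivariance holds up to \<open>2 \<delta>\<close>, because \<open>(1, g x)\<close> and \<open>(g, x)\<close> differ only in the terms added
  to \<open>d\<close>, and \<open>w g \<le> 1\<close>.
\<close>

section \<open>Ultrafilters\<close>

text \<open>
  Ultrafilters are the minimal proper filters.  Zorn's lemma provides one: the infimum of a chain of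
  proper filters is proper, because an event of the infimum is already an event of a member.
\<close>

lemma proper_filter_le_ultrafilter:
  assumes "F \<noteq> bot"
  obtains U where "U \<le> F" "U \<noteq> bot" "\<And>P. eventually P U \<or> eventually (\<lambda>i. \<not> P i) U"
proof -
  define A where "A = {U. U \<le> F \<and> U \<noteq> bot}"
  let ?P = "\<lambda>U V :: 'a filter. V \<le> U"
  have "\<exists>U\<in>A. \<forall>V\<in>A. ?P U V \<longrightarrow> V = U"
  proof (rule predicate_Zorn)
    show "partial_order_on A (relation_of ?P A)"
      by (auto simp: partial_order_on_def preorder_on_def refl_on_def trans_def antisym_def relation_of_def)
  next
    fix C assume C: "C \<in> Chains (relation_of ?P A)"
    then have CA: "C \<subseteq> A" and tot: "\<And>U V. U \<in> C \<Longrightarrow> V \<in> C \<Longrightarrow> V \<le> U \<or> U \<le> V"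
      by (auto simp: Chains_def relation_of_def)
    show "\<exists>U\<in>A. \<forall>V\<in>C. U \<le> V"
    proof (cases "C = {}")
      case True
      then show ?thesis using assms by (auto simp: A_def)
    next
      case False
      have "eventually P (Inf C) \<longleftrightarrow> (\<exists>b\<in>C. eventually P b)" for P
        using False
      proof (rule eventually_Inf_base)
        fix U V assume "U \<in> C" "V \<in> C"
        then show "\<exists>W\<in>C. W \<le> inf U V"
          using tot[of U V] by (metis inf.bounded_iff order_refl)
      qed
      then have "Inf C \<noteq> bot"
        using CA by (auto simp: trivial_limit_def A_def)
      moreover have "Inf C \<le> F"
        using False CA by (auto simp: A_def intro: Inf_lower2)
      ultimately show ?thesis by (auto simp: A_def Inf_lower)
    qed
  qed
  then obtain U where U: "U \<le> F" "U \<noteq> bot" and max: "\<And>V. V \<le> U \<Longrightarrow> V \<noteq> bot \<Longrightarrow> V = U"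
    by (auto simp: A_def intro: order_trans)
  have "eventually P U \<or> eventually (\<lambda>i. \<not> P i) U" for P
  proof (rule disjCI)
    assume "\<not> eventually (\<lambda>i. \<not> P i) U"
    then have "inf U (principal {i. P i}) \<noteq> bot"
      by (simp add: trivial_limit_def eventually_inf_principal)
    \<comment> \<open>Restricting \<open>U\<close> to \<open>P\<close> keeps it proper, so minimality forces \<open>P\<close> to hold in \<open>U\<close> already.\<close>
    then have "inf U (principal {i. P i}) = U" by (intro max) auto
    then have "U \<le> principal {i. P i}" by (simp add: le_iff_inf)
    then show "eventually P U" by (simp add: le_principal)
  qed
  with U show ?thesis by (rule that)
qed

section \<open>Finite quotients and length functions\<close>

text \<open>
  The intersection of one finite-index kernel per element of \<open>B\<close>.  A coset of it is determined by the
  tuple of values of the homomorphisms, which ranges over a finite product of finite groups.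
\<close>

lemma residually_finite_separating_normal:
  fixes G :: "('g, 'm) monoid_scheme" (structure)
  assumes "residually_finite G" "finite B"
  obtains N where "N \<lhd> G" "finite (rcosets N)" "N \<inter> B \<subseteq> {\<one>}"
proof -
  interpret group G using assms by (simp add: residually_finite_def)
  define B' where "B' = B \<inter> carrier G - {\<one>}"
  have "\<forall>b\<in>B'. \<exists>(Q :: nat monoid) \<psi>.
      group Q \<and> finite (carrier Q) \<and> \<psi> \<in> hom G Q \<and> \<psi> b \<noteq> \<one>\<^bsub>Q\<^esub>"
    using assms(1) by (auto simp: residually_finite_def B'_def)
  then obtain Q :: "'g \<Rightarrow> nat monoid" and \<psi> where
    Q: "\<And>b. b \<in> B' \<Longrightarrow> group (Q b)" "\<And>b. b \<in> B' \<Longrightarrow> finite (carrier (Q b))"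
      "\<And>b. b \<in> B' \<Longrightarrow> \<psi> b \<in> hom G (Q b)" "\<And>b. b \<in> B' \<Longrightarrow> \<psi> b b \<noteq> \<one>\<^bsub>Q b\<^esub>"
    by metis
  have gh: "group_hom G (Q b) (\<psi> b)" if "b \<in> B'" for b
    using Q that by (simp add: group_hom_def group_hom_axioms_def is_group)
  define N where "N = {g \<in> carrier G. \<forall>b\<in>B'. \<psi> b g = \<one>\<^bsub>Q b\<^esub>}"
  have "subgroup N G"
  proof (rule subgroupI)
    show "N \<noteq> {}" using group_hom.hom_one[OF gh] by (auto simp: N_def)
  next
    fix g assume g: "g \<in> N"
    have "\<psi> b (inv g) = \<one>\<^bsub>Q b\<^esub>" if b: "b \<in> B'" for b
    proof -
      interpret h: group_hom G "Q b" "\<psi> b" by (rule gh[OF b])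
      show ?thesis using g b by (simp add: N_def)
    qed
    then show "inv g \<in> N" using g by (simp add: N_def)
  next
    fix g g' assume g: "g \<in> N" "g' \<in> N"
    have "\<psi> b (g \<otimes> g') = \<one>\<^bsub>Q b\<^esub>" if b: "b \<in> B'" for b
    proof -
      interpret h: group_hom G "Q b" "\<psi> b" by (rule gh[OF b])
      show ?thesis using g b by (simp add: N_def)
    qed
    then show "g \<otimes> g' \<in> N" using g by (simp add: N_def)
  qed (auto simp: N_def)
  moreover have "x \<otimes> n \<otimes> inv x \<in> N" if "x \<in> carrier G" "n \<in> N" for x n
  proof -
    have "\<psi> b (x \<otimes> n \<otimes> inv x) = \<one>\<^bsub>Q b\<^esub>" if b: "b \<in> B'" for b
    proof -
      interpret h: group_hom G "Q b" "\<psi> b" by (rule gh[OF b])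
      show ?thesis using \<open>x \<in> carrier G\<close> \<open>n \<in> N\<close> b by (simp add: N_def)
    qed
    then show ?thesis using that by (simp add: N_def)
  qed
  ultimately have "N \<lhd> G" by (simp add: normal_inv_iff)
  moreover have "finite (rcosets N)"
  proof (rule finite_surj)
    show "finite (Pi\<^sub>E B' (\<lambda>b. carrier (Q b)))"
      using assms Q by (intro finite_PiE) (auto simp: B'_def)
    show "rcosets N \<subseteq> (\<lambda>f. {g \<in> carrier G. \<forall>b\<in>B'. \<psi> b g = f b}) ` Pi\<^sub>E B' (\<lambda>b. carrier (Q b))"
    proof
      fix C assume "C \<in> rcosets N"
      then obtain x where x: "x \<in> carrier G" "C = N #> x" by (auto simp: RCOSETS_def)
      have "C = {g \<in> carrier G. \<forall>b\<in>B'. \<psi> b g = (\<lambda>b\<in>B'. \<psi> b x) b}"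
      proof (intro equalityI subsetI)
        fix g assume "g \<in> C"
        then obtain n where n: "n \<in> N" "g = n \<otimes> x" using x by (auto simp: r_coset_def)
        have "\<psi> b g = \<psi> b x" if b: "b \<in> B'" for b
        proof -
          interpret h: group_hom G "Q b" "\<psi> b" by (rule gh[OF b])
          show ?thesis using x n b by (simp add: N_def)
        qed
        then show "g \<in> {g \<in> carrier G. \<forall>b\<in>B'. \<psi> b g = (\<lambda>b\<in>B'. \<psi> b x) b}"
          using x n by (simp add: N_def)
      next
        fix g assume g: "g \<in> {g \<in> carrier G. \<forall>b\<in>B'. \<psi> b g = (\<lambda>b\<in>B'. \<psi> b x) b}"
        have "\<psi> b (g \<otimes> inv x) = \<one>\<^bsub>Q b\<^esub>" if b: "b \<in> B'" for b
        proof -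
          interpret h: group_hom G "Q b" "\<psi> b" by (rule gh[OF b])
          show ?thesis using x g b by simp
        qed
        then have "g \<otimes> inv x \<in> N" using x g by (simp add: N_def)
        then show "g \<in> C" using x g
          by (auto simp: r_coset_def m_assoc intro!: bexI[of _ "g \<otimes> inv x"])
      qed
      moreover have "(\<lambda>b\<in>B'. \<psi> b x) \<in> Pi\<^sub>E B' (\<lambda>b. carrier (Q b))"
        using x group_hom.hom_closed[OF gh] by auto
      ultimately show "C \<in> (\<lambda>f. {g \<in> carrier G. \<forall>b\<in>B'. \<psi> b g = f b}) ` Pi\<^sub>E B' (\<lambda>b. carrier (Q b))"
        by blast
    qed
  qed
  moreover have "N \<inter> B \<subseteq> {\<one>}"
    using Q(4) by (auto simp: N_def B'_def)
  ultimately show ?thesis by (rule that)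
qed

primrec words_of_length :: "('g, 'm) monoid_scheme \<Rightarrow> 'g set \<Rightarrow> nat \<Rightarrow> 'g set" where
  "words_of_length G T 0 = {\<one>\<^bsub>G\<^esub>}"
| "words_of_length G T (Suc k) = words_of_length G T k <#>\<^bsub>G\<^esub> T"

context group
begin

lemma words_of_length_subset: "T \<subseteq> carrier G \<Longrightarrow> words_of_length G T k \<subseteq> carrier G"
  by (induction k) (auto simp: set_mult_def)

lemma finite_words_of_length: "finite T \<Longrightarrow> finite (words_of_length G T k)"
proof (induction k)
  case (Suc k)
  have "words_of_length G T (Suc k) = (\<lambda>(x, t). x \<otimes> t) ` (words_of_length G T k \<times> T)"
    by (auto simp: set_mult_def)
  with Suc show ?case by simp
qed simp

lemma words_of_length_add:
  "T \<subseteq> carrier G \<Longrightarrow> words_of_length G T (j + k) = words_of_length G T j <#> words_of_length G T k"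
proof (induction k)
  case 0
  then show ?case using words_of_length_subset[of T j] by (force simp: set_mult_def)
next
  case (Suc k)
  then show ?case using words_of_length_subset[of T] by (simp add: set_mult_assoc)
qed

lemma words_of_length_inv:
  assumes T: "T \<subseteq> carrier G" "\<And>t. t \<in> T \<Longrightarrow> inv t \<in> T"
  shows "x \<in> words_of_length G T k \<Longrightarrow> inv x \<in> words_of_length G T k"
proof (induction k arbitrary: x)
  case (Suc k)
  then obtain y t where y: "y \<in> words_of_length G T k" "t \<in> T" "x = y \<otimes> t"
    by (auto simp: set_mult_def)
  have "inv x = inv t \<otimes> inv y"
    using y T(1) words_of_length_subset[OF T(1), of k] by (metis inv_mult_group subsetD)
  moreover have "inv t \<in> words_of_length G T 1"
    using T y by (force simp: set_mult_def)
  ultimately have "inv x \<in> words_of_length G T (1 + k)"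
    using Suc.IH[OF y(1)] unfolding words_of_length_add[OF T(1)] set_mult_def by blast
  then show ?case by simp
qed simp

text \<open>
  The word length for the finite set \<open>T = F \<union> F\<^sup>-\<^sup>1\<close>, cut off at \<open>M\<close>.  The cap makes the function finite
  on elements outside the subgroup generated by \<open>F\<close>, which matters as \<open>G\<close> need not be finitely
  generated; as \<open>T\<close> is finite, only finitely many elements lie below the cap.
\<close>

lemma exists_capped_length:
  assumes F: "finite F" "F \<subseteq> carrier G" and M: "M > 0"
  obtains w :: "'a \<Rightarrow> nat" where
    "w \<one> = 0" "\<And>g. g \<in> carrier G \<Longrightarrow> w g = 0 \<Longrightarrow> g = \<one>"
    "\<And>g. g \<in> carrier G \<Longrightarrow> w (inv g) = w g"
    "\<And>g h. g \<in> carrier G \<Longrightarrow> h \<in> carrier G \<Longrightarrow> w (g \<otimes> h) \<le> w g + w h"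
    "\<And>g. g \<in> F \<Longrightarrow> w g \<le> 1" "finite {g \<in> carrier G. w g < M}"
proof -
  define T where "T = F \<union> (\<lambda>g. inv g) ` F"
  have T: "T \<subseteq> carrier G" "\<And>t. t \<in> T \<Longrightarrow> inv t \<in> T" "finite T"
    using F by (auto simp: T_def)
  define P where "P g k \<longleftrightarrow> M \<le> k \<or> g \<in> words_of_length G T k" for g k
  define w where "w g = (LEAST k. P g k)" for g
  have Pw: "P g (w g)" for g
    unfolding w_def by (rule LeastI[of "P g" M]) (simp add: P_def)
  have le: "P g k \<Longrightarrow> w g \<le> k" for g k
    unfolding w_def by (rule Least_le)
  show ?thesis
  proof (rule that)
    show "w \<one> = 0" using le[of \<one> 0] by (simp add: P_def)
    show "g = \<one>" if "w g = 0" for g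
      using Pw[of g] that M by (simp add: P_def)
    have inv_le: "w (inv g) \<le> w g" for g
      by (rule le) (use Pw[of g] words_of_length_inv[OF T(1,2)] in \<open>auto simp: P_def\<close>)
    show "w (inv g) = w g" if "g \<in> carrier G" for g
      using inv_le[of g] inv_le[of "inv g"] that by simp
    show "w (g \<otimes> h) \<le> w g + w h" for g h
    proof (rule le)
      show "P (g \<otimes> h) (w g + w h)"
        using Pw[of g] Pw[of h] words_of_length_add[OF T(1)] by (auto simp: P_def set_mult_def)
    qed
    show "w g \<le> 1" if "g \<in> F" for g
    proof (rule le)
      have "g \<in> carrier G" using that F by auto
      then have "g \<in> words_of_length G T 1" using that by (force simp: T_def set_mult_def)
      then show "P g 1" by (simp add: P_def)
    qed
    have "{g \<in> carrier G. w g < M} \<subseteq> (\<Union>k<M. words_of_length G T k)"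
      using Pw by (force simp: P_def)
    then show "finite {g \<in> carrier G. w g < M}"
      by (rule finite_subset) (simp add: finite_words_of_length T)
  qed
qed

end

section \<open>Distances between blocks\<close>

text \<open>
  The infimum distance need not satisfy the triangle inequality on arbitrary sets; for orbits of a group
  of isometries it holds, by the homogeneity that \<open>gap_triangle\<close> assumes.
\<close>

definition gap :: "('z \<Rightarrow> 'z \<Rightarrow> real) \<Rightarrow> 'z set \<Rightarrow> 'z set \<Rightarrow> real"
  where "gap \<sigma> A B = (INF (a, b) \<in> A \<times> B. \<sigma> a b)"

lemma gap_le:
  assumes "a \<in> A" "b \<in> B" "\<And>x y. x \<in> A \<Longrightarrow> y \<in> B \<Longrightarrow> 0 \<le> \<sigma> x y"
  shows "gap \<sigma> A B \<le> \<sigma> a b"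
proof -
  have "bdd_below ((\<lambda>(a, b). \<sigma> a b) ` (A \<times> B))"
    using assms(3) by (intro bdd_belowI2[of _ 0]) auto
  from cINF_lower[OF this, of "(a, b)"] show ?thesis
    using assms(1,2) by (simp add: gap_def)
qed

lemma gap_ge:
  assumes "A \<noteq> {}" "B \<noteq> {}" "\<And>a b. a \<in> A \<Longrightarrow> b \<in> B \<Longrightarrow> r \<le> \<sigma> a b"
  shows "r \<le> gap \<sigma> A B"
  unfolding gap_def using assms by (intro cINF_greatest) auto

lemma gap_approx:
  assumes "A \<noteq> {}" "B \<noteq> {}" "e > 0"
  obtains a b where "a \<in> A" "b \<in> B" "\<sigma> a b < gap \<sigma> A B + e"
proof (rule ccontr)
  assume "\<not> thesis"
  then have "gap \<sigma> A B + e \<le> gap \<sigma> A B"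
    using assms(1,2) that by (intro gap_ge) (auto simp: not_less[symmetric])
  with \<open>e > 0\<close> show False by simp
qed

text \<open>
  Nearly optimal pairs \<open>a, b\<close> and \<open>b', c\<close> need not share their point in \<open>B\<close>; homogeneity moves the second
  pair so that they do.
\<close>

lemma gap_triangle:
  assumes ne: "A \<noteq> {}" "B \<noteq> {}" "C \<noteq> {}"
    and nonneg: "\<And>a c. a \<in> A \<Longrightarrow> c \<in> C \<Longrightarrow> 0 \<le> \<sigma> a c"
    and tri: "\<And>a b c. a \<in> A \<Longrightarrow> b \<in> B \<Longrightarrow> c \<in> C \<Longrightarrow> \<sigma> a c \<le> \<sigma> a b + \<sigma> b c"
    and hom: "\<And>b b' c. b \<in> B \<Longrightarrow> b' \<in> B \<Longrightarrow> c \<in> C \<Longrightarrow> \<exists>c'\<in>C. \<sigma> b' c' = \<sigma> b c"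
  shows "gap \<sigma> A C \<le> gap \<sigma> A B + gap \<sigma> B C"
proof (rule field_le_epsilon)
  fix e :: real assume e: "e > 0"
  obtain a b where ab: "a \<in> A" "b \<in> B" "\<sigma> a b < gap \<sigma> A B + e / 2"
    using gap_approx[OF ne(1,2), of "e / 2"] e by auto
  obtain b' c where bc: "b' \<in> B" "c \<in> C" "\<sigma> b' c < gap \<sigma> B C + e / 2"
    using gap_approx[OF ne(2,3), of "e / 2"] e by auto
  obtain c' where c': "c' \<in> C" "\<sigma> b c' = \<sigma> b' c" using hom ab bc by metis
  have "gap \<sigma> A C \<le> \<sigma> a c'" using ab c' nonneg by (intro gap_le)
  also have "\<dots> \<le> \<sigma> a b + \<sigma> b c'" using ab c' by (intro tri)
  finally show "gap \<sigma> A C \<le> gap \<sigma> A B + gap \<sigma> B C + e" using ab bc c' by simp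
qed

lemma gap_commute: "(\<And>a b. a \<in> A \<Longrightarrow> b \<in> B \<Longrightarrow> \<sigma> a b = \<sigma> b a) \<Longrightarrow> gap \<sigma> A B = gap \<sigma> B A"
proof -
  assume *: "\<And>a b. a \<in> A \<Longrightarrow> b \<in> B \<Longrightarrow> \<sigma> a b = \<sigma> b a"
  have "gap \<sigma> A B = (INF (a, b) \<in> A \<times> B. \<sigma> b a)"
    unfolding gap_def by (rule INF_cong) (auto intro: *)
  also have "(\<lambda>(a, b). \<sigma> b a) ` (A \<times> B) = (\<lambda>(b, a). \<sigma> b a) ` (B \<times> A)"
    by (auto simp: image_iff)
  finally show ?thesis by (simp add: gap_def)
qed

lemma gap_image:
  assumes "\<And>a b. a \<in> A \<Longrightarrow> b \<in> B \<Longrightarrow> \<sigma> (T a) (T b) = \<sigma> a b"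
  shows "gap \<sigma> (T ` A) (T ` B) = gap \<sigma> A B"
proof -
  have "gap \<sigma> (T ` A) (T ` B) = (INF z \<in> (\<lambda>(a, b). (T a, T b)) ` (A \<times> B). case z of (a, b) \<Rightarrow> \<sigma> a b)"
    unfolding gap_def by (rule arg_cong[where f = Inf], rule image_cong) auto
  also have "\<dots> = (INF (a, b) \<in> A \<times> B. \<sigma> (T a) (T b))"
    by (simp add: image_image case_prod_unfold)
  also have "\<dots> = gap \<sigma> A B"
    unfolding gap_def by (rule INF_cong) (auto simp: assms)
  finally show ?thesis .
qed

section \<open>Relabelling a finite action\<close>

text \<open>
  This reduces the construction of a finite \<open>G\<close>-metric space to its essential axioms: the action and
  the distance may behave arbitrarily off the space, and points of any type become natural numbers.
\<close>

lemma finite_isometric_action_on_nat: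
  fixes G :: "('g, 'm) monoid_scheme" (structure)
    and Z :: "'z set" and \<rho> :: "'z \<Rightarrow> 'z \<Rightarrow> real"
  assumes G: "group G" and fin: "finite Z"
    and nonneg: "\<And>x y. x \<in> Z \<Longrightarrow> y \<in> Z \<Longrightarrow> 0 \<le> \<rho> x y"
    and comm: "\<And>x y. x \<in> Z \<Longrightarrow> y \<in> Z \<Longrightarrow> \<rho> x y = \<rho> y x"
    and zero: "\<And>x y. x \<in> Z \<Longrightarrow> y \<in> Z \<Longrightarrow> \<rho> x y = 0 \<longleftrightarrow> x = y"
    and tri: "\<And>x y z. x \<in> Z \<Longrightarrow> y \<in> Z \<Longrightarrow> z \<in> Z \<Longrightarrow> \<rho> x z \<le> \<rho> x y + \<rho> y z"
    and cl: "\<And>g x. g \<in> carrier G \<Longrightarrow> x \<in> Z \<Longrightarrow> T g x \<in> Z"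
    and one: "\<And>x. x \<in> Z \<Longrightarrow> T \<one> x = x"
    and mult: "\<And>g h x. g \<in> carrier G \<Longrightarrow> h \<in> carrier G \<Longrightarrow> x \<in> Z \<Longrightarrow> T (g \<otimes> h) x = T g (T h x)"
    and iso: "\<And>g x y. g \<in> carrier G \<Longrightarrow> x \<in> Z \<Longrightarrow> y \<in> Z \<Longrightarrow> \<rho> (T g x) (T g y) = \<rho> x y"
  obtains Y :: "nat set" and \<eta> \<phi> h where
    "finite Y" "isometric_action G Y \<eta> \<phi>" "h \<in> Z \<rightarrow> Y"
    "\<And>x y. x \<in> Z \<Longrightarrow> y \<in> Z \<Longrightarrow> \<eta> (h x) (h y) = \<rho> x y"
    "\<And>g x. g \<in> carrier G \<Longrightarrow> x \<in> Z \<Longrightarrow> \<phi> g (h x) = h (T g x)"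
proof -
  interpret group G by (rule G)
  obtain h :: "'z \<Rightarrow> nat" where inj: "inj_on h Z"
    using finite_imp_inj_to_nat_seg[OF fin] by blast
  define Y where "Y = h ` Z"
  define k where "k = the_inv_into Z h"
  have kh [simp]: "k (h x) = x" if "x \<in> Z" for x
    using that inj by (simp add: k_def the_inv_into_f_f)
  have hY: "h x \<in> Y" if "x \<in> Z" for x using that by (simp add: Y_def)
  \<comment> \<open>The locale of metric spaces asks for nonnegativity and symmetry on the whole type.\<close>
  define \<eta> where "\<eta> i j = (if i \<in> Y \<and> j \<in> Y then \<rho> (k i) (k j) else 0)" for i j
  define \<phi> where "\<phi> g = (\<lambda>i\<in>Y. h (T g (k i)))" for g
  have \<eta>h: "\<eta> (h x) (h y) = \<rho> x y" if "x \<in> Z" "y \<in> Z" for x y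
    using that by (simp add: \<eta>_def hY)
  have \<phi>h: "\<phi> g (h x) = h (T g x)" if "x \<in> Z" for g x
    using that by (simp add: \<phi>_def hY)
  have met: "Metric_space Y \<eta>"
  proof
    fix x y
    show "0 \<le> \<eta> x y" by (auto simp: \<eta>_def Y_def nonneg)
    show "\<eta> x y = \<eta> y x" by (auto simp: \<eta>_def Y_def comm)
  next
    fix x y assume "x \<in> Y" "y \<in> Y"
    then show "\<eta> x y = 0 \<longleftrightarrow> x = y"
      using inj by (auto simp: Y_def \<eta>h zero inj_on_eq_iff)
  next
    fix x y z assume "x \<in> Y" "y \<in> Y" "z \<in> Y"
    then show "\<eta> x z \<le> \<eta> x y + \<eta> y z" by (auto simp: Y_def \<eta>h tri)
  qed
  have \<phi>cl: "\<phi> g y \<in> Y" if "g \<in> carrier G" "y \<in> Y" for g y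
    using that by (auto simp: Y_def \<phi>h cl)
  have \<phi>mult: "\<phi> (g \<otimes> g') y = \<phi> g (\<phi> g' y)" if "g \<in> carrier G" "g' \<in> carrier G" "y \<in> Y" for g g' y
    using that by (auto simp: Y_def \<phi>h cl mult)
  have \<phi>one: "\<phi> \<one> y = y" if "y \<in> Y" for y
    using that by (auto simp: Y_def \<phi>h one)
  have Bij: "\<phi> g \<in> Bij Y" if g: "g \<in> carrier G" for g
  proof -
    have "bij_betw (\<phi> g) Y Y"
      by (rule bij_betw_byWitness[where f' = "\<phi> (inv g)"])
        (use g \<phi>cl in \<open>auto simp: \<phi>one simp flip: \<phi>mult\<close>)
    then show ?thesis by (simp add: Bij_def \<phi>_def)
  qed
  have "\<phi> \<in> hom G (BijGroup Y)"
  proof (rule homI)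
    fix g g' assume gh: "g \<in> carrier G" "g' \<in> carrier G"
    have "\<phi> (g \<otimes> g') = compose Y (\<phi> g) (\<phi> g')"
    proof
      fix y show "\<phi> (g \<otimes> g') y = compose Y (\<phi> g) (\<phi> g') y"
        using gh by (cases "y \<in> Y") (simp_all add: compose_def \<phi>mult, simp add: \<phi>_def)
    qed
    then show "\<phi> (g \<otimes> g') = \<phi> g \<otimes>\<^bsub>BijGroup Y\<^esub> \<phi> g'"
      using gh Bij by (simp add: BijGroup_def)
  qed (use Bij in \<open>simp add: BijGroup_def\<close>)
  then have "group_action G Y \<phi>"
    by (simp add: group_action_def group_hom_def group_hom_axioms_def group_BijGroup)
  moreover have "isometric_action_axioms G Y \<eta> \<phi>"
    by unfold_locales (auto simp: Y_def \<phi>h \<eta>h cl iso)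
  ultimately have "isometric_action G Y \<eta> \<phi>" using met by (simp add: isometric_action_def)
  moreover have "finite Y" using fin by (simp add: Y_def)
  moreover have "h \<in> Z \<rightarrow> Y" using hY by blast
  ultimately show ?thesis using that \<eta>h \<phi>h by blast
qed

section \<open>Finite approximations\<close>

text \<open>
  Let \<open>G\<close> act by isometries on a uniformly discrete metric space \<open>Z\<close>, and let \<open>N\<close> be a normal subgroup
  with finitely many orbits.  The orbits carry the infimum distance: the uniform gap \<open>\<delta>\<close> keeps
  distinct orbits apart, the isometries in \<open>N\<close> give homogeneity, and normality of \<open>N\<close> makes \<open>G\<close> permute
  the orbits.
\<close>

lemma finite_orbit_space_action:
  fixes G :: "('g, 'm) monoid_scheme" (structure)
    and Z :: "'z set" and \<sigma> :: "'z \<Rightarrow> 'z \<Rightarrow> real" and T :: "'g \<Rightarrow> 'z \<Rightarrow> 'z"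
  defines "orb \<equiv> \<lambda>N z. (\<lambda>n. T n z) ` N"
  assumes N: "N \<lhd> G" and fin: "finite (orb N ` Z)"
    and cl: "\<And>g x. g \<in> carrier G \<Longrightarrow> x \<in> Z \<Longrightarrow> T g x \<in> Z"
    and one: "\<And>x. x \<in> Z \<Longrightarrow> T \<one> x = x"
    and mult: "\<And>g h x. g \<in> carrier G \<Longrightarrow> h \<in> carrier G \<Longrightarrow> x \<in> Z \<Longrightarrow> T (g \<otimes> h) x = T g (T h x)"
    and iso: "\<And>g x y. g \<in> carrier G \<Longrightarrow> x \<in> Z \<Longrightarrow> y \<in> Z \<Longrightarrow> \<sigma> (T g x) (T g y) = \<sigma> x y"
    and refl: "\<And>x. x \<in> Z \<Longrightarrow> \<sigma> x x = 0"
    and comm: "\<And>x y. x \<in> Z \<Longrightarrow> y \<in> Z \<Longrightarrow> \<sigma> x y = \<sigma> y x"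
    and tri: "\<And>x y z. x \<in> Z \<Longrightarrow> y \<in> Z \<Longrightarrow> z \<in> Z \<Longrightarrow> \<sigma> x z \<le> \<sigma> x y + \<sigma> y z"
    and \<delta>: "\<delta> > 0" "\<And>x y. x \<in> Z \<Longrightarrow> y \<in> Z \<Longrightarrow> x \<noteq> y \<Longrightarrow> \<delta> \<le> \<sigma> x y"
  obtains Y :: "nat set" and \<eta> \<phi> q where
    "finite Y" "isometric_action G Y \<eta> \<phi>" "q \<in> Z \<rightarrow> Y"
    "\<And>x y. x \<in> Z \<Longrightarrow> y \<in> Z \<Longrightarrow> \<eta> (q x) (q y) = gap \<sigma> (orb N x) (orb N y)"
    "\<And>g x. g \<in> carrier G \<Longrightarrow> x \<in> Z \<Longrightarrow> \<phi> g (q x) = q (T g x)"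
proof -
  interpret normal N G by (rule N)
  have nonneg: "0 \<le> \<sigma> x y" if "x \<in> Z" "y \<in> Z" for x y
    using \<delta> refl that by (cases "x = y") force+
  have orbI: "T n x \<in> orb N x" if "n \<in> N" for n x
    using that by (simp add: orb_def)
  have self: "x \<in> orb N x" if "x \<in> Z" for x
    using orbI[OF subgroup.one_closed[OF subgroup_axioms], of x] one that by simp
  have sub: "orb N x \<subseteq> Z" if "x \<in> Z" for x
    using that cl by (auto simp: orb_def)
  have move: "\<exists>n\<in>N. z = T n y" if xyz: "x \<in> Z" "y \<in> orb N x" "z \<in> orb N x" for x y z
  proof -
    obtain m n where mn: "m \<in> N" "y = T m x" "n \<in> N" "z = T n x"
      using xyz by (auto simp: orb_def)
    have "T (n \<otimes> inv m) y = T (n \<otimes> inv m \<otimes> m) x" using mn xyz by (simp add: mult)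
    also have "\<dots> = z" using mn by (simp add: m_assoc)
    finally show ?thesis using mn by (intro bexI[of _ "n \<otimes> inv m"]) auto
  qed
  have stay: "T n y \<in> orb N x" if "x \<in> Z" "y \<in> orb N x" "n \<in> N" for x y n
    using that orbI[of "n \<otimes> _" x] by (auto simp: orb_def simp flip: mult)
  have orb_eq: "orb N y = orb N x" if "x \<in> Z" "y \<in> orb N x" for x y
    using move[OF that] stay[OF that] by (auto simp: orb_def)
  have T_orb: "T g ` orb N x = orb N (T g x)" if g: "g \<in> carrier G" and x: "x \<in> Z" for g x
  proof -
    have "T g ` orb N x = (\<lambda>k. T k x) ` (g <# N)"
      using g x by (auto simp: orb_def l_coset_def image_iff mult)
    also have "g <# N = N #> g" using coset_eq g by simp
    also have "(\<lambda>k. T k x) ` (N #> g) = orb N (T g x)"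
      using g x by (auto simp: orb_def r_coset_def image_iff mult)
    finally show ?thesis .
  qed
  have gap_nonneg: "0 \<le> gap \<sigma> (orb N x) (orb N y)" if "x \<in> Z" "y \<in> Z" for x y
    using self[OF that(1)] self[OF that(2)] sub[OF that(1)] sub[OF that(2)]
    by (intro gap_ge nonneg) auto
  have gap_zero: "gap \<sigma> (orb N x) (orb N y) = 0 \<longleftrightarrow> orb N x = orb N y" if xy: "x \<in> Z" "y \<in> Z" for x y
  proof
    assume "orb N x = orb N y"
    moreover have "gap \<sigma> (orb N x) (orb N x) \<le> \<sigma> x x"
      using self[OF xy(1)] sub[OF xy(1)] by (intro gap_le nonneg) auto
    ultimately show "gap \<sigma> (orb N x) (orb N y) = 0"
      using gap_nonneg[OF xy] refl[OF xy(1)] by simp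
  next
    assume 0: "gap \<sigma> (orb N x) (orb N y) = 0"
    show "orb N x = orb N y"
    proof (rule ccontr)
      assume ne: "orb N x \<noteq> orb N y"
      have "\<delta> \<le> gap \<sigma> (orb N x) (orb N y)"
      proof (rule gap_ge)
        fix a b assume ab: "a \<in> orb N x" "b \<in> orb N y"
        then have "a \<noteq> b" using ne orb_eq xy by metis
        then show "\<delta> \<le> \<sigma> a b" using \<delta>(2) ab sub xy by blast
      qed (use self xy in auto)
      with 0 \<delta> show False by simp
    qed
  qed
  have gap_tri: "gap \<sigma> (orb N x) (orb N z) \<le> gap \<sigma> (orb N x) (orb N y) + gap \<sigma> (orb N y) (orb N z)"
    if xyz: "x \<in> Z" "y \<in> Z" "z \<in> Z" for x y z
  proof (rule gap_triangle)
    fix b b' c assume b: "b \<in> orb N y" "b' \<in> orb N y" and c: "c \<in> orb N z"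
    obtain n where n: "n \<in> N" "b' = T n b" using move[OF xyz(2) b] by blast
    have "\<sigma> b' (T n c) = \<sigma> b c"
      unfolding n(2) using n(1) b c sub xyz by (intro iso) auto
    then show "\<exists>c'\<in>orb N z. \<sigma> b' c' = \<sigma> b c" using stay[OF xyz(3) c n(1)] by blast
  next
    fix a b c assume "a \<in> orb N x" "b \<in> orb N y" "c \<in> orb N z"
    then show "\<sigma> a c \<le> \<sigma> a b + \<sigma> b c" using sub xyz by (intro tri) auto
  next
    fix a c assume "a \<in> orb N x" "c \<in> orb N z"
    then show "0 \<le> \<sigma> a c" using sub xyz by (intro nonneg) auto
  qed (use self xyz in auto)
  have gap_iso: "gap \<sigma> (T g ` orb N x) (T g ` orb N y) = gap \<sigma> (orb N x) (orb N y)"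
    if "g \<in> carrier G" "x \<in> Z" "y \<in> Z" for g x y
    using that sub by (intro gap_image iso) auto
  have gap_comm: "gap \<sigma> (orb N x) (orb N y) = gap \<sigma> (orb N y) (orb N x)" if "x \<in> Z" "y \<in> Z" for x y
    using that sub by (intro gap_commute comm) auto
  obtain Y :: "nat set" and \<eta> \<phi> h where Y:
    "finite Y" "isometric_action G Y \<eta> \<phi>" "h \<in> orb N ` Z \<rightarrow> Y"
    and h: "\<And>A B. A \<in> orb N ` Z \<Longrightarrow> B \<in> orb N ` Z \<Longrightarrow> \<eta> (h A) (h B) = gap \<sigma> A B"
    "\<And>g A. g \<in> carrier G \<Longrightarrow> A \<in> orb N ` Z \<Longrightarrow> \<phi> g (h A) = h (T g ` A)"
  proof (rule finite_isometric_action_on_nat[OF is_group fin, of "gap \<sigma>" "\<lambda>g. (`) (T g)"], goal_cases)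
    case (6 A)
    then obtain x where x: "x \<in> Z" "A = orb N x" by auto
    then show ?case using T_orb[of \<one> x] one by simp
  next
    case (8 g A B)
    then show ?case using gap_iso by blast
  next
    case (7 g k A)
    then obtain x where x: "x \<in> Z" "A = orb N x" by auto
    with 7 show ?case by (simp add: T_orb mult cl)
  qed (auto simp: gap_nonneg gap_zero gap_comm T_orb cl intro: gap_tri)
  show ?thesis
  proof (rule that[of Y \<eta> \<phi> "\<lambda>x. h (orb N x)"])
    show "\<phi> g (h (orb N x)) = h (orb N (T g x))" if "g \<in> carrier G" "x \<in> Z" for g x
      using that by (simp add: h T_orb)
  qed (use Y h in auto)
qed

text \<open>
  The finite \<open>G\<close>-metric space is the space of \<open>N\<close>-orbits in \<open>G \<times> S'\<close> for the metric \<open>\<sigma>\<close> described at the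
  beginning, where \<open>S'\<close> is \<open>S\<close> with at most one point of \<open>X\<close> added.
  The orbit of \<open>(a, s)\<close> is the coset \<open>N a\<close> paired with \<open>s\<close>, so there are finitely many.
\<close>

lemma residually_finite_finite_approximation:
  fixes G :: "('g, 'm) monoid_scheme" (structure)
    and X :: "'x set" and d :: "'x \<Rightarrow> 'x \<Rightarrow> real" and \<alpha> :: "'g \<Rightarrow> 'x \<Rightarrow> 'x"
  assumes rf: "residually_finite G" and act: "isometric_action G X d \<alpha>"
    and F: "finite F" "F \<subseteq> carrier G" and S: "finite S" "S \<subseteq> X" and e: "e > 0"
  shows "\<exists>(Y :: nat set) \<eta> \<phi> p. finite Y \<and> isometric_action G Y \<eta> \<phi> \<and> p \<in> X \<rightarrow> Y \<and>
    (\<forall>x\<in>S. \<forall>y\<in>S. \<bar>\<eta> (p x) (p y) - d x y\<bar> \<le> e) \<and>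
    (\<forall>g\<in>F. \<forall>x\<in>S. \<alpha> g x \<in> S \<longrightarrow> \<eta> (p (\<alpha> g x)) (\<phi> g (p x)) \<le> e)"
proof -
  interpret isometric_action G X d \<alpha> by (rule act)
  interpret group G using rf by (simp add: residually_finite_def)
  \<comment> \<open>\<open>S\<close> may be empty while \<open>X\<close> is not; a point is added so that \<open>p\<close> has a value on all of \<open>X\<close>.\<close>
  obtain S' where S': "finite S'" "S \<subseteq> S'" "S' \<subseteq> X" "S' = {} \<Longrightarrow> X = {}"
  proof (cases "X = {}")
    case False
    then obtain x where "x \<in> X" by blast
    then show ?thesis using S that[of "insert x S"] by auto
  qed (use S that in auto)
  \<comment> \<open>In the equivariance estimate the penalty is paid twice: for \<open>w g \<le> 1\<close> and for \<open>g x \<noteq> x\<close>.\<close>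
  define \<delta> where "\<delta> = e / 2"
  have \<delta>: "\<delta> > 0" using e by (simp add: \<delta>_def)
  obtain K where K: "\<And>x y. x \<in> S' \<Longrightarrow> y \<in> S' \<Longrightarrow> d x y \<le> K"
    using bdd_above_finite[of "(\<lambda>(x, y). d x y) ` (S' \<times> S')"] S'(1) by (force simp: bdd_above_def)
  \<comment> \<open>Beyond this length the penalty alone outweighs every distance in \<open>S'\<close>.\<close>
  obtain M :: nat where M: "K / \<delta> < M" "M > 0"
    using reals_Archimedean2[of "max 0 (K / \<delta>)"] by auto
  obtain w :: "'g \<Rightarrow> nat" where w:
    "w \<one> = 0" "\<And>g. g \<in> carrier G \<Longrightarrow> w g = 0 \<Longrightarrow> g = \<one>"
    "\<And>g. g \<in> carrier G \<Longrightarrow> w (inv g) = w g"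
    "\<And>g h. g \<in> carrier G \<Longrightarrow> h \<in> carrier G \<Longrightarrow> w (g \<otimes> h) \<le> w g + w h"
    "\<And>g. g \<in> F \<Longrightarrow> w g \<le> 1" "finite {g \<in> carrier G. w g < M}"
    using exists_capped_length[OF F M(2)] by blast
  obtain N where N: "N \<lhd> G" "finite (rcosets N)" "N \<inter> {g \<in> carrier G. w g < M} \<subseteq> {\<one>}"
    by (rule residually_finite_separating_normal[OF rf w(6)])
  interpret N: normal N G by (rule N(1))
  define Z where "Z = carrier G \<times> S'"
  define T :: "'g \<Rightarrow> 'g \<times> 'x \<Rightarrow> 'g \<times> 'x" where "T g z = (g \<otimes> fst z, snd z)" for g z
  define \<sigma> :: "'g \<times> 'x \<Rightarrow> 'g \<times> 'x \<Rightarrow> real" where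
    "\<sigma> = (\<lambda>(a, s) (b, t). d (\<alpha> a s) (\<alpha> b t) + \<delta> * (w (inv a \<otimes> b) + of_bool (s \<noteq> t)))"
  define orb where "orb z = (\<lambda>n. T n z) ` N" for z
  have \<alpha>X: "\<alpha> g x \<in> X" if "g \<in> carrier G" "x \<in> S'" for g x
    using element_image that S'(3) by blast
  have \<alpha>_one: "\<alpha> \<one> x = x" if "x \<in> X" for x
    using that by (simp flip: id_eq_one)
  have inv_mult_eq_one: "inv a \<otimes> b = \<one> \<longleftrightarrow> a = b" if "a \<in> carrier G" "b \<in> carrier G" for a b
    using that inv_solve_left'[of \<one> a b] by auto
  have cancel: "inv a \<otimes> (a \<otimes> b) = b" "a \<otimes> (inv a \<otimes> b) = b"
    if "a \<in> carrier G" "b \<in> carrier G" for a b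
    using that by (simp_all flip: m_assoc)
  have inv_mult_cancel: "inv (g \<otimes> a) \<otimes> (g \<otimes> b) = inv a \<otimes> b"
    if "g \<in> carrier G" "a \<in> carrier G" "b \<in> carrier G" for g a b
    using that by (simp add: inv_mult_group m_assoc cancel)
  have w_comm: "w (inv a \<otimes> b) = w (inv b \<otimes> a)" if "a \<in> carrier G" "b \<in> carrier G" for a b
    using w(3)[of "inv a \<otimes> b"] that by (simp add: inv_mult_group)
  have w_tri: "w (inv a \<otimes> c) \<le> w (inv a \<otimes> b) + w (inv b \<otimes> c)"
    if "a \<in> carrier G" "b \<in> carrier G" "c \<in> carrier G" for a b c
    using w(4)[of "inv a \<otimes> b" "inv b \<otimes> c"] that
    by (simp add: m_assoc cancel)
  have nonneg\<sigma>: "0 \<le> \<sigma> x y" for x y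
    using \<delta> by (auto simp: \<sigma>_def split: prod.split)
  have fin: "finite (orb ` Z)"
  proof (rule finite_subset)
    show "orb ` Z \<subseteq> (\<lambda>(A, s). A \<times> {s}) ` ((rcosets N) \<times> S')"
    proof
      fix B assume "B \<in> orb ` Z"
      then obtain g s where gs: "g \<in> carrier G" "s \<in> S'" "B = orb (g, s)" by (auto simp: Z_def)
      then have "B = (N #> g) \<times> {s}" by (auto simp: orb_def T_def r_coset_def)
      moreover have "N #> g \<in> rcosets N" using gs by (auto simp: RCOSETS_def)
      ultimately show "B \<in> (\<lambda>(A, s). A \<times> {s}) ` ((rcosets N) \<times> S')"
        using gs by (intro image_eqI[of _ _ "(N #> g, s)"]) auto
    qed
  qed (simp add: N S')
  have iso\<sigma>: "\<sigma> (T g x) (T g y) = \<sigma> x y" if g: "g \<in> carrier G" and "x \<in> Z" "y \<in> Z" for g x y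
  proof -
    obtain a r b s where xy: "x = (a, r)" "y = (b, s)" by (cases x, cases y)
    have G: "a \<in> carrier G" "b \<in> carrier G" and X: "r \<in> S'" "s \<in> S'"
      using that by (auto simp: xy Z_def)
    have "d (\<alpha> (g \<otimes> a) r) (\<alpha> (g \<otimes> b) s) = d (\<alpha> a r) (\<alpha> b s)"
      using g G X S'(3) by (simp add: composition_rule subset_iff isometric \<alpha>X)
    then show ?thesis by (simp add: xy T_def \<sigma>_def inv_mult_cancel g G)
  qed
  have comm\<sigma>: "\<sigma> x y = \<sigma> y x" if "x \<in> Z" "y \<in> Z" for x y
  proof -
    obtain a r b s where xy: "x = (a, r)" "y = (b, s)" by (cases x, cases y)
    have "d (\<alpha> a r) (\<alpha> b s) = d (\<alpha> b s) (\<alpha> a r)" by (rule commute)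
    moreover have "w (inv a \<otimes> b) = w (inv b \<otimes> a)" using that by (intro w_comm) (auto simp: xy Z_def)
    ultimately show ?thesis by (auto simp: xy \<sigma>_def)
  qed
  have tri\<sigma>: "\<sigma> x z \<le> \<sigma> x y + \<sigma> y z" if "x \<in> Z" "y \<in> Z" "z \<in> Z" for x y z
  proof -
    obtain a r b s c t where xyz: "x = (a, r)" "y = (b, s)" "z = (c, t)"
      by (cases x, cases y, cases z)
    have G: "a \<in> carrier G" "b \<in> carrier G" "c \<in> carrier G" and X: "r \<in> S'" "s \<in> S'" "t \<in> S'"
      using that by (auto simp: xyz Z_def)
    have "w (inv a \<otimes> c) + of_bool (r \<noteq> t) \<le>
        (w (inv a \<otimes> b) + of_bool (r \<noteq> s)) + (w (inv b \<otimes> c) + of_bool (s \<noteq> t))"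
      using w_tri[OF G] by auto
    then have "\<delta> * real (w (inv a \<otimes> c) + of_bool (r \<noteq> t)) \<le>
        \<delta> * real ((w (inv a \<otimes> b) + of_bool (r \<noteq> s)) + (w (inv b \<otimes> c) + of_bool (s \<noteq> t)))"
      using \<delta> by (intro mult_left_mono of_nat_mono) auto
    moreover have "d (\<alpha> a r) (\<alpha> c t) \<le> d (\<alpha> a r) (\<alpha> b s) + d (\<alpha> b s) (\<alpha> c t)"
      using G X by (intro triangle \<alpha>X)
    ultimately show ?thesis by (simp add: xyz \<sigma>_def algebra_simps)
  qed
  have disc\<sigma>: "\<delta> \<le> \<sigma> x y" if xy: "x \<in> Z" "y \<in> Z" "x \<noteq> y" for x y
  proof -
    obtain a r b s where ab: "x = (a, r)" "y = (b, s)" by (cases x, cases y)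
    have G: "a \<in> carrier G" "b \<in> carrier G" using xy by (auto simp: ab Z_def)
    have "1 \<le> w (inv a \<otimes> b) + of_bool (r \<noteq> s)"
    proof (cases "r = s")
      case True
      then have "a \<noteq> b" using xy(3) ab by blast
      then have "inv a \<otimes> b \<noteq> \<one>" using inv_mult_eq_one[OF G] by blast
      then have "w (inv a \<otimes> b) \<noteq> 0" using w(2)[of "inv a \<otimes> b"] G by auto
      then show ?thesis by simp
    qed simp
    then have "\<delta> * real 1 \<le> \<delta> * real (w (inv a \<otimes> b) + of_bool (r \<noteq> s))"
      using \<delta> by (intro mult_left_mono of_nat_mono) auto
    then have "\<delta> \<le> d (\<alpha> a r) (\<alpha> b s) + \<delta> * real (w (inv a \<otimes> b) + of_bool (r \<noteq> s))"
      by (intro add_increasing nonneg) simp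
    then show ?thesis by (simp add: ab \<sigma>_def)
  qed
  have T: "T g x \<in> Z" "T \<one> x = x" "\<sigma> x x = 0" if "g \<in> carrier G" "x \<in> Z" for g x
    using that \<alpha>X by (auto simp: T_def Z_def \<sigma>_def w)
  have T_mult: "T (g \<otimes> h) x = T g (T h x)" if "g \<in> carrier G" "h \<in> carrier G" "x \<in> Z" for g h x
    using that by (auto simp: T_def Z_def m_assoc)
  obtain Y :: "nat set" and \<eta> \<phi> q where Y:
    "finite Y" "isometric_action G Y \<eta> \<phi>" "q \<in> Z \<rightarrow> Y"
    and \<eta>: "\<And>x y. x \<in> Z \<Longrightarrow> y \<in> Z \<Longrightarrow> \<eta> (q x) (q y) = gap \<sigma> (orb x) (orb y)"
    and \<phi>: "\<And>g x. g \<in> carrier G \<Longrightarrow> x \<in> Z \<Longrightarrow> \<phi> g (q x) = q (T g x)"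
    by (rule finite_orbit_space_action[OF N(1), where T = T and \<sigma> = \<sigma> and Z = Z and \<delta> = \<delta>,
          folded orb_def, OF fin T(1) T(2)[OF one_closed] T_mult iso\<sigma> T(3)[OF one_closed] comm\<sigma> tri\<sigma> \<delta> disc\<sigma>])
      blast+
  obtain s0 where s0: "X \<noteq> {} \<Longrightarrow> s0 \<in> S'" using S'(4) by blast
  define p where "p x = q (\<one>, if x \<in> S' then x else s0)" for x
  have pS: "p x = q (\<one>, x)" "(\<one>, x) \<in> Z" "x \<in> S'" if "x \<in> S" for x
    using that S' by (auto simp: p_def Z_def)
  have self: "z \<in> orb z" if "z \<in> Z" for z
    using that by (auto simp: orb_def T_def Z_def image_iff intro!: bexI[of _ \<one>])
  have \<eta>_le: "\<eta> (q x) (q y) \<le> \<sigma> x y" if "x \<in> Z" "y \<in> Z" for x y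
    unfolding \<eta>[OF that] using self that nonneg\<sigma> by (intro gap_le)
  show ?thesis
  proof (intro exI[of _ Y] exI[of _ \<eta>] exI[of _ \<phi>] exI[of _ p] conjI ballI impI Y(1,2))
    show "p \<in> X \<rightarrow> Y" 
    proof
      fix x assume "x \<in> X"
      then have "(\<one>, if x \<in> S' then x else s0) \<in> Z" using s0 by (auto simp: Z_def)
      then show "p x \<in> Y" using Y(3) by (auto simp: p_def)
    qed
  next
    fix x y assume xy: "x \<in> S" "y \<in> S"
    have X: "x \<in> X" "y \<in> X" using xy S by auto
    have "\<eta> (p x) (p y) \<le> \<sigma> (\<one>, x) (\<one>, y)"
      using \<eta>_le pS xy by simp
    also have "\<dots> \<le> d x y + e"
      using X e by (auto simp: \<sigma>_def w \<delta>_def \<alpha>_one)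
    finally have "\<eta> (p x) (p y) \<le> d x y + e" .
    moreover have "d x y \<le> \<eta> (p x) (p y)"
      unfolding pS(1)[OF xy(1)] pS(1)[OF xy(2)] \<eta>[OF pS(2)[OF xy(1)] pS(2)[OF xy(2)]]
    proof (rule gap_ge)
      fix u v assume "u \<in> orb (\<one>, x)" "v \<in> orb (\<one>, y)"
      then obtain n m where nm: "n \<in> N" "m \<in> N" "u = (n, x)" "v = (m, y)"
        by (auto simp: orb_def T_def)
      have uv: "\<sigma> u v = d (\<alpha> n x) (\<alpha> m y) + \<delta> * (w (inv n \<otimes> m) + of_bool (x \<noteq> y))"
        by (simp add: nm \<sigma>_def)
      \<comment> \<open>Representatives moved by the same element are as far apart as \<open>x\<close> and \<open>y\<close>; otherwise the
        length of \<open>n\<^sup>-\<^sup>1 m\<close> reaches the cap.\<close>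
      show "d x y \<le> \<sigma> u v"
      proof (cases "n = m")
        case True
        then have "d (\<alpha> n x) (\<alpha> m y) = d x y" using nm X isometric by simp
        then show ?thesis using \<delta> unfolding uv by simp
      next
        case False
        then have "inv n \<otimes> m \<noteq> \<one>" using inv_mult_eq_one nm N.mem_carrier by blast
        moreover have "inv n \<otimes> m \<in> N" using nm by simp
        ultimately have "M \<le> w (inv n \<otimes> m)" using N(3) N.mem_carrier by (force simp: not_less[symmetric])
        then have "\<delta> * M \<le> \<delta> * (w (inv n \<otimes> m) + of_bool (x \<noteq> y))"
          using \<delta> by (intro mult_left_mono) (auto simp: add_increasing2)
        moreover have "d x y \<le> \<delta> * M"
          using K[of x y] pS(3) xy M(1) \<delta> by (simp add: field_simps)
        ultimately show ?thesis using nonneg[of "\<alpha> n x" "\<alpha> m y"] unfolding uv by linarith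
      qed
    qed (use self[OF pS(2)] xy in blast)+
    ultimately show "\<bar>\<eta> (p x) (p y) - d x y\<bar> \<le> e" using e by auto
  next
    fix g x assume g: "g \<in> F" and x: "x \<in> S" "\<alpha> g x \<in> S"
    have gG: "g \<in> carrier G" using g F by auto
    \<comment> \<open>The pairs \<open>(1, g x)\<close> and \<open>(g, x)\<close> stand for the same point of \<open>X\<close>.\<close>
    have "\<eta> (p (\<alpha> g x)) (\<phi> g (p x)) = \<eta> (q (\<one>, \<alpha> g x)) (q (g, x))"
      using pS x gG by (simp add: \<phi> T_def)
    also have "\<dots> \<le> \<sigma> (\<one>, \<alpha> g x) (g, x)"
      using pS x gG by (intro \<eta>_le) (auto simp: Z_def)
    also have "\<dots> = \<delta> * (w g + of_bool (\<alpha> g x \<noteq> x))"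
    proof -
      have "\<alpha> g x \<in> X" using x S by auto
      then show ?thesis using gG by (simp add: \<sigma>_def \<alpha>_one)
    qed
    also have "\<dots> \<le> \<delta> * 2"
      using w(5)[OF g] \<delta> by (intro mult_left_mono) auto
    finally show "\<eta> (p (\<alpha> g x)) (\<phi> g (p x)) \<le> e" by (simp add: \<delta>_def)
  qed
qed

section \<open>The embedding into the ultraproduct\<close>

theorem corollary2p2:
  fixes G :: "('g, 'm) monoid_scheme"
    and X :: "'x set" and d :: "'x \<Rightarrow> 'x \<Rightarrow> real" and \<alpha> :: "'g \<Rightarrow> 'x \<Rightarrow> 'x"
  assumes "residually_finite G"
    and "isometric_action G X d \<alpha>"
  shows "\<exists>(I :: ('g set \<times> 'x set \<times> nat) set) U
           (Y :: 'g set \<times> 'x set \<times> nat \<Rightarrow> nat set) \<eta> \<phi>.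
           ultrafilter_on I U \<and>
           (\<forall>i\<in>I. finite (Y i) \<and> isometric_action G (Y i) (\<eta> i) (\<phi> i)) \<and>
           (\<exists>f \<in> X \<rightarrow> up_space I U Y \<eta>.
              (\<forall>x\<in>X. \<forall>y\<in>X. up_dist U \<eta> (f x) (f y) = ennreal (d x y)) \<and>
              (\<forall>g\<in>carrier G. \<forall>x\<in>X. f (\<alpha> g x) = up_action I U Y \<eta> \<phi> g (f x)))"
proof -
  interpret isometric_action G X d \<alpha> by (rule assms)
  have G: "group G" using assms by (simp add: residually_finite_def)
  define I :: "('g set \<times> 'x set \<times> nat) set" where
    "I = {(F, S, n). finite F \<and> F \<subseteq> carrier G \<and> finite S \<and> S \<subseteq> X}"
  \<comment> \<open>The tails of the directed set \<open>I\<close>; a filter containing all of them makes every approximation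
    requirement hold eventually.\<close>
  define above where "above F S n = {(F', S', n') \<in> I. F \<subseteq> F' \<and> S \<subseteq> S' \<and> n \<le> n'}" for F S n
  define B where "B = (\<lambda>(F, S, n). principal (above F S n)) ` I"
  have above_I: "above F S n \<subseteq> I" for F S n by (auto simp: above_def)
  have above_Int: "above (F \<union> F') (S \<union> S') (max n n') \<subseteq> above F S n \<inter> above F' S' n'" for F F' S S' n n'
    by (auto simp: above_def)
  have base: "eventually P (Inf B) \<longleftrightarrow> (\<exists>b\<in>B. eventually P b)" for P
  proof (rule eventually_Inf_base)
    show "B \<noteq> {}" by (auto simp: B_def I_def)
  next
    fix b b' assume "b \<in> B" "b' \<in> B"
    then obtain F S n F' S' n' where i: "(F, S, n) \<in> I" "(F', S', n') \<in> I"
      and b: "b = principal (above F S n)" "b' = principal (above F' S' n')"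
      by (auto simp: B_def)
    have "(F \<union> F', S \<union> S', max n n') \<in> I" using i by (auto simp: I_def)
    then have "principal (above (F \<union> F') (S \<union> S') (max n n')) \<in> B" by (force simp: B_def)
    then show "\<exists>x\<in>B. x \<le> inf b b'"
      using above_Int by (intro bexI) (auto simp: b)
  qed
  have "Inf B \<noteq> bot"
  proof -
    have "b \<noteq> bot" if b: "b \<in> B" for b
    proof -
      obtain F S n where i: "(F, S, n) \<in> I" "b = principal (above F S n)"
        using b by (auto simp: B_def)
      then have "(F, S, n) \<in> above F S n" by (simp add: above_def)
      then show ?thesis by (auto simp: i(2) principal_eq_bot_iff)
    qed
    then show ?thesis using base by (simp add: trivial_limit_def)
  qed
  then obtain U where U: "U \<le> Inf B" "U \<noteq> bot" "\<And>P. eventually P U \<or> eventually (\<lambda>i. \<not> P i) U"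
    by (rule proper_filter_le_ultrafilter) blast
  have ev: "eventually (\<lambda>i. i \<in> above F S n) U" if "(F, S, n) \<in> I" for F S n
  proof -
    have "eventually (\<lambda>i. i \<in> above F S n) (Inf B)"
      unfolding base using that by (auto simp: B_def eventually_principal intro!: bexI[of _ "(F, S, n)"])
    then show ?thesis by (rule filter_leD[OF U(1)])
  qed
  have ultra: "ultrafilter_on I U"
  proof -
    have "({}, {}, 0) \<in> I" by (simp add: I_def)
    from ev[OF this] have "eventually (\<lambda>i. i \<in> I) U"
      by (rule eventually_mono) (use above_I in blast)
    then show ?thesis using U by (simp add: ultrafilter_on_def le_principal)
  qed
  define approx where "approx = (\<lambda>(F, S, n) (Y :: nat set) \<eta> \<phi> p.
      finite Y \<and> isometric_action G Y \<eta> \<phi> \<and> p \<in> X \<rightarrow> Y \<and>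
      (\<forall>x\<in>S. \<forall>y\<in>S. \<bar>\<eta> (p x) (p y) - d x y\<bar> \<le> inverse (real (Suc n))) \<and>
      (\<forall>g\<in>F. \<forall>x\<in>S. \<alpha> g x \<in> S \<longrightarrow> \<eta> (p (\<alpha> g x)) (\<phi> g (p x)) \<le> inverse (real (Suc n))))"
  have "\<exists>Y \<eta> \<phi> p. approx i Y \<eta> \<phi> p" if "i \<in> I" for i
  proof -
    obtain F S n where i: "i = (F, S, n)" by (cases i)
    show ?thesis
      unfolding i approx_def prod.case
      using \<open>i \<in> I\<close> by (intro residually_finite_finite_approximation assms) (auto simp: i I_def)
  qed
  then obtain Y \<eta> \<phi> p where approx: "\<And>i. i \<in> I \<Longrightarrow> approx i (Y i) (\<eta> i) (\<phi> i) (p i)"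
    by metis
  have fin: "finite (Y i)" and act: "isometric_action G (Y i) (\<eta> i) (\<phi> i)" and p: "p i \<in> X \<rightarrow> Y i"
    if "i \<in> I" for i
    using approx[OF that] by (auto simp: approx_def split: prod.splits)
  have dist_p: "\<bar>\<eta> i (p i x) (p i y) - d x y\<bar> \<le> inverse (real (Suc N))"
    if i: "i \<in> above F S N" and "x \<in> S" "y \<in> S" for i F S N x y
  proof -
    obtain F' S' n where i': "i = (F', S', n)" "i \<in> I" "S \<subseteq> S'" "N \<le> n"
      using i by (auto simp: above_def)
    have "x \<in> S'" "y \<in> S'" using i'(3) that by auto
    then have "\<bar>\<eta> i (p i x) (p i y) - d x y\<bar> \<le> inverse (real (Suc n))"
      using approx[OF i'(2)] unfolding i'(1) approx_def by simp
    also have "\<dots> \<le> inverse (real (Suc N))" using i' by (intro le_imp_inverse_le) auto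
    finally show ?thesis .
  qed
  have equiv_p: "\<eta> i (p i (\<alpha> g x)) (\<phi> i g (p i x)) \<le> inverse (real (Suc N))"
    if i: "i \<in> above F S N" and "g \<in> F" "x \<in> S" "\<alpha> g x \<in> S" for i F S N g x
  proof -
    obtain F' S' n where i': "i = (F', S', n)" "i \<in> I" "F \<subseteq> F'" "S \<subseteq> S'" "N \<le> n"
      using i by (auto simp: above_def)
    have "g \<in> F'" "x \<in> S'" "\<alpha> g x \<in> S'" using i'(3,4) that by auto
    then have "\<eta> i (p i (\<alpha> g x)) (\<phi> i g (p i x)) \<le> inverse (real (Suc n))"
      using approx[OF i'(2)] unfolding i'(1) approx_def by simp
    also have "\<dots> \<le> inverse (real (Suc N))" using i' by (intro le_imp_inverse_le) auto
    finally show ?thesis .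
  qed
  interpret fam: isometric_action_family G I U Y \<eta> \<phi>
    using ultra act G by (rule isometric_action_family.intro)
  define v where "v x = (\<lambda>i\<in>I. p i x)" for x
  have v: "v x \<in> fam.E" if "x \<in> X" for x
    using that p by (auto simp: v_def)
  have inverse_small: "\<exists>n. inverse (real (Suc n)) < e" if "e > 0" for e :: real
    using reals_Archimedean[OF that] .
  have dist_v: "fam.D (v x) (v y) = ennreal (d x y)" if xy: "x \<in> X" "y \<in> X" for x y
  proof (rule fam.pdistI, rule tendsto_ennrealI, rule tendstoI)
    fix e :: real assume "e > 0"
    then obtain N where N: "inverse (real (Suc N)) < e" using inverse_small by blast
    have "({}, {x, y}, N) \<in> I" using xy by (simp add: I_def)
    from ev[OF this] show "\<forall>\<^sub>F i in U. dist (\<eta> i (v x i) (v y i)) (d x y) < e"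
    proof (rule eventually_mono)
      fix i assume i: "i \<in> above {} {x, y} N"
      then have "i \<in> I" using above_I by blast
      then show "dist (\<eta> i (v x i) (v y i)) (d x y) < e"
        using dist_p[OF i, of x y] N by (simp add: v_def dist_real_def)
    qed
  qed
  have equiv_v: "fam.D (v (\<alpha> g x)) (fam.c g (v x)) = 0" if g: "g \<in> carrier G" and x: "x \<in> X" for g x
  proof -
    have "fam.D (v (\<alpha> g x)) (fam.c g (v x)) = ennreal 0"
    proof (rule fam.pdistI, rule tendsto_ennrealI, rule tendstoI)
      fix e :: real assume "e > 0"
      then obtain N where N: "inverse (real (Suc N)) < e" using inverse_small by blast
      have "({g}, {x, \<alpha> g x}, N) \<in> I" using g x element_image[OF g x] by (simp add: I_def)
      from ev[OF this]
      show "\<forall>\<^sub>F i in U. dist (\<eta> i (v (\<alpha> g x) i) (fam.c g (v x) i)) 0 < e"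
      proof (rule eventually_mono)
        fix i assume i: "i \<in> above {g} {x, \<alpha> g x} N"
        then have "i \<in> I" using above_I by blast
        then show "dist (\<eta> i (v (\<alpha> g x) i) (fam.c g (v x) i)) 0 < e"
          using equiv_p[OF i, of g x] N Metric_space.nonneg[OF fam.met]
          by (simp add: v_def fam.c_def dist_real_def)
      qed
    qed
    then show ?thesis by simp
  qed
  define f where "f x = fam.R `` {v x}" for x
  have "f \<in> X \<rightarrow> fam.S" using v fam.up_classI by (auto simp: f_def)
  moreover have "up_dist U \<eta> (f x) (f y) = ennreal (d x y)" if "x \<in> X" "y \<in> X" for x y
    using that by (simp add: f_def fam.up_dist_class v dist_v)
  moreover have "f (\<alpha> g x) = fam.a g (f x)" if g: "g \<in> carrier G" and x: "x \<in> X" for g x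
  proof -
    have "(v (\<alpha> g x), fam.c g (v x)) \<in> fam.R"
      using equiv_v[OF g x] v[OF x] v[OF element_image[OF g x refl]] fam.coord_closed[OF g]
      by (simp add: up_rel_def)
    then have "fam.R `` {v (\<alpha> g x)} = fam.R `` {fam.c g (v x)}"
      by (rule equiv_class_eq[OF fam.equiv_rel])
    then show ?thesis using g v[OF x] by (simp add: f_def fam.up_action_class)
  qed
  ultimately show ?thesis
    using ultra fin act by (intro exI[of _ I] exI[of _ U] exI[of _ Y] exI[of _ \<eta>] exI[of _ \<phi>] conjI bexI[of _ f]) auto
qed

end
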